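(* There exists $d_0$ such that for every fixed integer $d\ge d_0$ the following holds. Let $\mathcal{G}$ be a random $d$-regular graph on $n$ vertices with a single grounded node $v_s$. Then the smallest eigenvalue $\lambda$ of the grounded Laplacian $L_g(\{v_s\})$ of $\mathcal{G}$ satisfies $\lambda=\Theta\left(\frac{d}{n}\right)$ asymptotically almost surely, i.e., there are constants $c_1,c_2>0$ such that $c_1\frac{d}{n}\le\lambda\le c_2\frac{d}{n}$ with probability tending to $1$ as $n\to\infty$.
   Context: For $3\le d<n$ with $dn$ even, a random $d$-regular graph on $n$ vertices is a graph drawn uniformly at random from the set of all (simple, undirected, labelled) $d$-regular graphs on $n$ nodes; the limit $n\to\infty$ is over $n$ with $dn$ even. The Laplacian of a graph is $L=D-A$ (degree matrix minus adjacency matrix); the grounded Laplacian $L_g(\{v_s\})$ is obtained from $L$ by removing the row and column corresponding to $v_s$. The grounded node $v_s$ is any fixed node of the labelled node set. *)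

theory Defs
  imports
    "HOL-Probability.Probability"
    "Jordan_Normal_Form.Determinant"
    "Jordan_Normal_Form.Spectral_Radius"
begin

text \<open>A simple undirected graph on the labelled vertex set \<open>{..<n}\<close> is given by its set of
  edges, each edge being a set of two distinct vertices.\<close>

definition simple_graphs :: "nat \<Rightarrow> nat set set set" where
  "simple_graphs n = Pow {e. e \<subseteq> {..<n} \<and> card e = 2}"

definition vertex_degree :: "nat set set \<Rightarrow> nat \<Rightarrow> nat" where
  "vertex_degree E v = card {e \<in> E. v \<in> e}"

definition regular_graphs :: "nat \<Rightarrow> nat \<Rightarrow> nat set set set" where
  "regular_graphs n d = {E \<in> simple_graphs n. \<forall>v<n. vertex_degree E v = d}"

lemma finite_simple_graphs: "finite (simple_graphs n)"
  by (simp add: simple_graphs_def)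

lemma finite_regular_graphs: "finite (regular_graphs n d)"
  by (simp add: regular_graphs_def finite_simple_graphs)

text \<open>The distribution below is meaningful only if \<open>regular_graphs n d\<close> is nonempty, that is,
  for \<open>d < n\<close> with \<open>d * n\<close> even (or \<open>n = 0\<close>).\<close>

definition random_regular_graph :: "nat \<Rightarrow> nat \<Rightarrow> nat set set pmf" where
  "random_regular_graph n d = pmf_of_set (regular_graphs n d)"

definition degree_matrix :: "nat \<Rightarrow> nat set set \<Rightarrow> real mat" where
  "degree_matrix n E =
     Matrix.mat n n (\<lambda>(i, j). if i = j then real (vertex_degree E i) else 0)"

definition adjacency_matrix :: "nat \<Rightarrow> nat set set \<Rightarrow> real mat" where
  "adjacency_matrix n E = Matrix.mat n n (\<lambda>(i, j). if {i, j} \<in> E then 1 else 0)"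

definition laplacian :: "nat \<Rightarrow> nat set set \<Rightarrow> real mat" where
  "laplacian n E = degree_matrix n E - adjacency_matrix n E"

definition grounded_laplacian :: "nat \<Rightarrow> nat set set \<Rightarrow> nat \<Rightarrow> real mat" where
  "grounded_laplacian n E s = mat_delete (laplacian n E) s s"

text \<open>Only real eigenvalues are considered; for the symmetric matrices to which this is applied
  there are no others, and the spectrum is finite and nonempty as soon as the dimension is
  positive.\<close>

definition smallest_eigenvalue :: "real mat \<Rightarrow> real" where
  "smallest_eigenvalue A = Min (spectrum A)"

end

theory Submission
  imports Defs
begin

text \<open>Up to the factor 2, the smallest eigenvalue \<open>\<lambda>\<close> of the grounded Laplacian is the minimum of the
  energy \<open>\<Sum>u v. a u v * (x u - x v)\<^sup>2\<close> over unit vectors \<open>x\<close> with \<open>x s = 0\<close>, where \<open>a\<close> is the adjacency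
  matrix (lemmas \<open>smallest_eigenvalue_rayleigh\<close> and \<open>grounded_laplacian_form\<close>).

  The upper bound holds for every regular graph: the function that is 1 away from \<open>s\<close> has energy of
  order \<open>d\<close> and squared norm \<open>n - 1\<close>.

  The lower bound needs edge expansion: every set of at most half of the vertices has at least as many
  edges leaving it as it has elements. An argument in the style of Cheeger then bounds the energy of \<open>x\<close>
  from below by a constant, depending on \<open>d\<close>, times the squared distance of \<open>x\<close> from the constant
  function at a median of \<open>x\<close>. Because \<open>x s = 0\<close>, the norm of \<open>x\<close> itself exceeds this distance by at most
  a factor of order \<open>sqrt n\<close>, so \<open>\<lambda>\<close> is at least of order \<open>1 / n\<close> (lemma \<open>grounded_poincare\<close>). As \<open>d\<close>
  is fixed, a constant depending on \<open>d\<close> turns this into \<open>d / n\<close>.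

  Expansion of a random regular graph is proved by switchings directly on simple graphs. If a
  set \<open>S\<close> of size \<open>k\<close> has a small cut, one replaces an edge inside \<open>S\<close> and one outside by two edges of
  the cut. There are many more ways to do this than to undo it, so every increase of the cut by two
  makes the graphs more numerous by a factor of order \<open>n * d\<^sup>2 / k\<close> (lemmas
  \<open>switching_double_count\<close> and \<open>cut_class_ratio\<close>). After \<open>2 * k\<close> such steps the gain beats the number of
  sets of size \<open>k\<close> provided that \<open>d\<close> is large, and a union bound over all \<open>S\<close> leaves a failure
  probability of at most \<open>1 / n\<close> (lemma \<open>nonexpanding_count\<close>). That \<open>d\<close> is constant while \<open>n\<close> grows makes
  the requirement that the switched graph be simple harmless, as it excludes only \<open>2 * d\<^sup>2\<close> of about
  \<open>d * n\<close> choices.\<close>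

section \<open>Degrees and links in regular graphs\<close>

definition nbrs :: "nat set set \<Rightarrow> nat \<Rightarrow> nat set" where
  "nbrs E v = {u. {v, u} \<in> E}"

text \<open>The pairs in \<open>links S T E\<close> are ordered. An edge inside \<open>S\<close> therefore occurs twice in
  \<open>links S S E\<close>, while an edge of the cut between \<open>S\<close> and its complement occurs once in
  \<open>links S ({..<n} - S) E\<close>, oriented away from \<open>S\<close>.\<close>

definition links :: "nat set \<Rightarrow> nat set \<Rightarrow> nat set set \<Rightarrow> (nat \<times> nat) set" where
  "links S T E = {(u, v). u \<in> S \<and> v \<in> T \<and> {u, v} \<in> E}"

lemma simple_graph_edge:
  assumes "E \<in> simple_graphs n" "{u, v} \<in> E"
  shows "u \<noteq> v" "u < n" "v < n"
proof -
  have "{u, v} \<subseteq> {..<n}" "card {u, v} = 2"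
    using assms by (auto simp: simple_graphs_def)
  then show "u \<noteq> v" "u < n" "v < n" by (auto simp: card_insert_if split: if_splits)
qed

lemma nbrs_subset: "E \<in> simple_graphs n \<Longrightarrow> nbrs E v \<subseteq> {..<n}"
  using simple_graph_edge by (auto simp: nbrs_def)

lemma vertex_degree_eq_card_nbrs:
  assumes "E \<in> simple_graphs n"
  shows "vertex_degree E v = card (nbrs E v)"
proof -
  have "\<exists>u\<in>nbrs E v. e = {v, u}" if "e \<in> E" "v \<in> e" for e
  proof -
    have "card e = 2" using that assms by (auto simp: simple_graphs_def)
    then obtain x y where "e = {x, y}" by (auto simp: card_2_iff)
    then show ?thesis using that by (auto simp: nbrs_def insert_commute)
  qed
  then have "{e \<in> E. v \<in> e} = (\<lambda>u. {v, u}) ` nbrs E v"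
    by (auto simp: nbrs_def)
  moreover have "inj_on (\<lambda>u. {v, u}) (nbrs E v)"
    by (auto simp: inj_on_def doubleton_eq_iff)
  ultimately show ?thesis by (simp add: vertex_degree_def card_image)
qed

lemma regular_graphs_simple: "E \<in> regular_graphs n d \<Longrightarrow> E \<in> simple_graphs n"
  by (simp add: regular_graphs_def)

lemma card_nbrs_regular:
  assumes "E \<in> regular_graphs n d" "v < n"
  shows "card (nbrs E v) = d"
  using assms vertex_degree_eq_card_nbrs[of E n v] by (auto simp: regular_graphs_def)

lemma finite_nbrs: "E \<in> simple_graphs n \<Longrightarrow> finite (nbrs E v)"
  by (rule finite_subset[OF nbrs_subset]) auto

lemma finite_links: "E \<in> simple_graphs n \<Longrightarrow> finite (links S T E)"
  by (rule finite_subset[of _ "{..<n} \<times> {..<n}"])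
    (auto simp: links_def dest: simple_graph_edge)

lemma card_links_swap: "card (links S T E) = card (links T S E)"
proof -
  have "bij_betw prod.swap (links S T E) (links T S E)"
    by (rule bij_betwI[where g = prod.swap]) (auto simp: links_def insert_commute)
  then show ?thesis by (rule bij_betw_same_card)
qed

text \<open>The \<open>d * card S\<close> ends of edges at \<open>S\<close> split according to whether the other end lies in \<open>S\<close>.
  A small cut thus forces many edges inside \<open>S\<close>.\<close>

lemma card_links_inside:
  assumes E: "E \<in> regular_graphs n d" and S: "S \<subseteq> {..<n}"
  shows "card (links S S E) + card (links S ({..<n} - S) E) = d * card S"
proof -
  note s = regular_graphs_simple[OF E]
  have "links S S E \<union> links S ({..<n} - S) E = Sigma S (nbrs E)"
    using simple_graph_edge(3)[OF s] by (auto simp: links_def nbrs_def)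
  moreover have "links S S E \<inter> links S ({..<n} - S) E = {}"
    by (auto simp: links_def)
  ultimately have "card (links S S E) + card (links S ({..<n} - S) E) = card (Sigma S (nbrs E))"
    using finite_links[OF s] by (metis card_Un_disjoint)
  also have "\<dots> = (\<Sum>v\<in>S. card (nbrs E v))"
    using S finite_nbrs[OF s] by (intro card_SigmaI) (auto intro: finite_subset)
  also have "\<dots> = (\<Sum>v\<in>S. d)"
    using card_nbrs_regular[OF E] S by (intro sum.cong) auto
  finally show ?thesis by (simp add: mult.commute)
qed

section \<open>Switchings across a cut\<close>

text \<open>With \<open>a\<close>, \<open>b\<close> inside \<open>S\<close> and \<open>x\<close>, \<open>y\<close> outside, replacing the edges \<open>ab\<close>, \<open>xy\<close> by
  \<open>ax\<close>, \<open>by\<close> preserves all degrees and enlarges the cut of \<open>S\<close> by exactly two edges. The two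
  non-edge conditions in \<open>switchings\<close> keep the graph simple and make the move reversible.\<close>

definition switch :: "nat \<Rightarrow> nat \<Rightarrow> nat \<Rightarrow> nat \<Rightarrow> nat set set \<Rightarrow> nat set set" where
  "switch a b x y E = (E - {{a, b}, {x, y}}) \<union> {{a, x}, {b, y}}"

definition switchings :: "nat \<Rightarrow> nat set \<Rightarrow> nat set set \<Rightarrow> ((nat \<times> nat) \<times> (nat \<times> nat)) set" where
  "switchings n S E = {((a, b), (x, y)). (a, b) \<in> links S S E
     \<and> (x, y) \<in> links ({..<n} - S) ({..<n} - S) E \<and> {a, x} \<notin> E \<and> {b, y} \<notin> E}"

lemma switch_regular:
  assumes E: "E \<in> regular_graphs n d" and S: "S \<subseteq> {..<n}"
    and sw: "((a, b), (x, y)) \<in> switchings n S E"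
  shows "switch a b x y E \<in> regular_graphs n d"
proof -
  note s = regular_graphs_simple[OF E]
  have ab: "a \<in> S" "b \<in> S" "{a, b} \<in> E" and xy: "x \<notin> S" "y \<notin> S" "x < n" "y < n" "{x, y} \<in> E"
    and new: "{a, x} \<notin> E" "{b, y} \<notin> E"
    using sw by (auto simp: switchings_def links_def)
  have ne: "a \<noteq> b" "x \<noteq> y" "a \<noteq> x" "a \<noteq> y" "b \<noteq> x" "b \<noteq> y" "a < n" "b < n"
    using ab xy S simple_graph_edge[OF s] by auto
  have fE: "finite E"
    using s by (auto simp: simple_graphs_def intro: rev_finite_subset[of "Pow {..<n}"])
  have simple: "switch a b x y E \<in> simple_graphs n"
    using s ne xy unfolding simple_graphs_def switch_def by auto
  have "vertex_degree (switch a b x y E) v = vertex_degree E v" for v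
  proof -
    \<comment> \<open>Degrees are sums of the weight \<open>w\<close> over the edges, and the two removed edges carry the same total weight as the two new ones because they have the same four ends.\<close>
    define w :: "nat set \<Rightarrow> nat" where "w e = (if v \<in> e then 1 else 0)" for e
    have deg: "vertex_degree F v = sum w F" if "finite F" for F
      using that by (simp add: vertex_degree_def w_def sum.If_cases Int_def)
    define R where "R = E - {{a, b}, {x, y}}"
    have ER: "E = insert {a, b} (insert {x, y} R)" "{a, b} \<notin> insert {x, y} R" "{x, y} \<notin> R"
      using ab xy ne by (auto simp: R_def doubleton_eq_iff)
    have SR: "switch a b x y E = insert {a, x} (insert {b, y} R)"
        "{a, x} \<notin> insert {b, y} R" "{b, y} \<notin> R"
      using new ne by (auto simp: R_def switch_def doubleton_eq_iff)
    have fR: "finite R" using fE by (simp add: R_def)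
    have "sum w E = w {a, b} + w {x, y} + sum w R"
      unfolding ER(1) using ER(2,3) fR by simp
    moreover have "sum w (switch a b x y E) = w {a, x} + w {b, y} + sum w R"
      unfolding SR(1) using SR(2,3) fR by simp
    moreover have "w {a, b} + w {x, y} = w {a, x} + w {b, y}"
      using ne by (auto simp: w_def)
    ultimately show ?thesis using deg fE by (simp add: switch_def)
  qed
  then show ?thesis using E simple by (simp add: regular_graphs_def)
qed

lemma links_switch:
  assumes E: "E \<in> regular_graphs n d" and S: "S \<subseteq> {..<n}"
    and sw: "((a, b), (x, y)) \<in> switchings n S E"
  shows "links S ({..<n} - S) (switch a b x y E)
       = insert (a, x) (insert (b, y) (links S ({..<n} - S) E))"
    and "(a, x) \<notin> insert (b, y) (links S ({..<n} - S) E)"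
    and "(b, y) \<notin> links S ({..<n} - S) E"
proof -
  note s = regular_graphs_simple[OF E]
  have ab: "a \<in> S" "b \<in> S" "{a, b} \<in> E" and xy: "x \<notin> S" "y \<notin> S" "x < n" "y < n" "{x, y} \<in> E"
    and new: "{a, x} \<notin> E" "{b, y} \<notin> E"
    using sw by (auto simp: switchings_def links_def)
  have "a \<noteq> b" using ab simple_graph_edge[OF s] by auto
  then show "links S ({..<n} - S) (switch a b x y E)
       = insert (a, x) (insert (b, y) (links S ({..<n} - S) E))"
    using ab xy by (auto simp: links_def switch_def doubleton_eq_iff)
  show "(a, x) \<notin> insert (b, y) (links S ({..<n} - S) E)" "(b, y) \<notin> links S ({..<n} - S) E"
    using new \<open>a \<noteq> b\<close> by (auto simp: links_def)
qed

lemma switch_undo: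
  assumes "((a, b), (x, y)) \<in> switchings n S E"
  shows "E = (switch a b x y E - {{a, x}, {b, y}}) \<union> {{a, b}, {x, y}}"
  using assms by (auto simp: switchings_def links_def switch_def)

text \<open>For each of the \<open>d * card S - j\<close> oriented edges inside \<open>S\<close>, all but at most \<open>2 * d\<^sup>2\<close> of the
  oriented edges outside can be switched with it: a forbidden \<open>(x, y)\<close> has \<open>x\<close> adjacent to \<open>a\<close>
  or \<open>y\<close> adjacent to \<open>b\<close>, hence is a path of length two from \<open>a\<close>, or a reversed one from \<open>b\<close>.\<close>

lemma card_switchings_ge:
  assumes E: "E \<in> regular_graphs n d" and S: "S \<subseteq> {..<n}"
    and j: "card (links S ({..<n} - S) E) = j"
  shows "(d * card S - j) * (d * (n - card S) - j - 2 * d\<^sup>2) \<le> card (switchings n S E)"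
proof -
  note s = regular_graphs_simple[OF E]
  let ?T = "{..<n} - S"
  have fS: "finite S" using S finite_subset by blast
  have inS: "card (links S S E) = d * card S - j"
    using card_links_inside[OF E S] j by simp
  have "{..<n} - ?T = S" using S by auto
  then have inT: "card (links ?T ?T E) = d * (n - card S) - j"
    using card_links_inside[OF E, of ?T] j card_links_swap[of ?T S E] S fS
    by (simp add: card_Diff_subset)
  define good where "good p = {(x, y) \<in> links ?T ?T E. {fst p, x} \<notin> E \<and> {snd p, y} \<notin> E}" for p
  have fgood: "finite (good p)" for p
    by (rule finite_subset[OF _ finite_links[OF s, of ?T ?T]]) (auto simp: good_def)
  have "d * (n - card S) - j - 2 * d\<^sup>2 \<le> card (good p)" if p: "p \<in> links S S E" for p
  proof -
    have lt: "fst p < n" "snd p < n" using p S by (auto simp: links_def)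
    define bad where "bad v = Sigma (nbrs E v) (nbrs E)" for v
    have card_bad: "card (bad v) = d\<^sup>2" if "v < n" for v
    proof -
      have "card (bad v) = (\<Sum>u\<in>nbrs E v. card (nbrs E u))"
        unfolding bad_def using finite_nbrs[OF s] by (intro card_SigmaI) auto
      also have "\<dots> = (\<Sum>u\<in>nbrs E v. d)"
        using nbrs_subset[OF s] card_nbrs_regular[OF E] by (intro sum.cong) auto
      finally show ?thesis using card_nbrs_regular[OF E that] by (simp add: power2_eq_square)
    qed
    have fbad: "finite (bad v)" for v
      unfolding bad_def using finite_nbrs[OF s] by auto
    let ?B = "bad (fst p) \<union> prod.swap ` bad (snd p)"
    have "links ?T ?T E - ?B \<subseteq> good p"
      by (auto simp: good_def bad_def nbrs_def links_def insert_commute image_iff)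
    then have "card (links ?T ?T E - ?B) \<le> card (good p)"
      using fgood by (rule card_mono[rotated])
    moreover have "card (links ?T ?T E) - card ?B \<le> card (links ?T ?T E - ?B)"
      by (rule diff_card_le_card_Diff) (simp add: fbad)
    moreover have "card ?B \<le> 2 * d\<^sup>2"
      using card_Un_le[of "bad (fst p)" "prod.swap ` bad (snd p)"] card_bad[OF lt(1)]
        card_bad[OF lt(2)] card_image_le[OF fbad, of prod.swap "snd p"] by linarith
    ultimately show ?thesis using inT by linarith
  qed
  then have "(\<Sum>p\<in>links S S E. d * (n - card S) - j - 2 * d\<^sup>2) \<le> (\<Sum>p\<in>links S S E. card (good p))"
    by (rule sum_mono)
  also have "\<dots> = card (Sigma (links S S E) good)"
    using finite_links[OF s] fgood by (intro card_SigmaI[symmetric]) auto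
  also have "Sigma (links S S E) good = switchings n S E"
    by (auto simp: switchings_def good_def)
  finally show ?thesis by (simp only: sum_constant of_nat_id inS)
qed

definition cut_class :: "nat \<Rightarrow> nat \<Rightarrow> nat set \<Rightarrow> nat \<Rightarrow> nat set set set" where
  "cut_class n d S j = {E \<in> regular_graphs n d. card (links S ({..<n} - S) E) = j}"

lemma finite_cut_class: "finite (cut_class n d S j)"
  by (simp add: cut_class_def finite_regular_graphs)

lemma cut_class_regular: "E \<in> cut_class n d S j \<Longrightarrow> E \<in> regular_graphs n d"
  by (simp add: cut_class_def)

text \<open>The switched graph together with the two new cut edges determines the original graph. As it
  has \<open>j + 2\<close> cut edges, each graph arises from at most \<open>(j + 2)\<^sup>2\<close> switchings.\<close>

lemma switching_double_count:
  assumes S: "S \<subseteq> {..<n}"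
  shows "card (cut_class n d S j) * ((d * card S - j) * (d * (n - card S) - j - 2 * d\<^sup>2))
       \<le> card (cut_class n d S (j + 2)) * (j + 2)\<^sup>2"
proof -
  let ?X = "Sigma (cut_class n d S j) (switchings n S)"
  let ?L = "\<lambda>E. links S ({..<n} - S) E"
  let ?Y = "Sigma (cut_class n d S (j + 2)) (\<lambda>E. ?L E \<times> ?L E)"
  define \<phi> :: "nat set set \<times> (nat \<times> nat) \<times> (nat \<times> nat) \<Rightarrow> nat set set \<times> (nat \<times> nat) \<times> (nat \<times> nat)"
    where "\<phi> = (\<lambda>(E, (a, b), (x, y)). (switch a b x y E, (a, x), (b, y)))"
  have fsw: "finite (switchings n S E)" if "E \<in> regular_graphs n d" for E
    by (rule finite_subset[OF _ finite_cartesian_product[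
            OF finite_links[OF regular_graphs_simple[OF that], of S S]
              finite_links[OF regular_graphs_simple[OF that], of "{..<n} - S" "{..<n} - S"]]])
      (auto simp: switchings_def)
  have "inj_on \<phi> ?X"
  proof (rule inj_onI)
    fix p q assume pq: "p \<in> ?X" "q \<in> ?X" "\<phi> p = \<phi> q"
    obtain E a b x y where p: "p = (E, (a, b), (x, y))" by (metis surj_pair)
    obtain F a' b' x' y' where q: "q = (F, (a', b'), (x', y'))" by (metis surj_pair)
    have eq: "a' = a" "b' = b" "x' = x" "y' = y" "switch a b x y E = switch a b x y F"
      using pq(3) by (auto simp: \<phi>_def p q)
    have "E = F"
      using switch_undo[of a b x y n S E] switch_undo[of a b x y n S F] pq(1,2) p q eq
      by (metis mem_Sigma_iff)
    then show "p = q" by (simp add: p q eq)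
  qed
  moreover have "\<phi> ` ?X \<subseteq> ?Y"
  proof
    fix q assume "q \<in> \<phi> ` ?X"
    then obtain E a b x y where q: "q = (switch a b x y E, (a, x), (b, y))"
      and E: "E \<in> cut_class n d S j" and sw: "((a, b), (x, y)) \<in> switchings n S E"
      by (auto simp: \<phi>_def)
    have R: "E \<in> regular_graphs n d" using E by (simp add: cut_class_def)
    have "finite (?L E)" using finite_links[OF regular_graphs_simple[OF R]] .
    then have "card (?L (switch a b x y E)) = j + 2"
      using links_switch[OF R S sw] E by (simp add: cut_class_def)
    then show "q \<in> ?Y"
      using q switch_regular[OF R S sw] links_switch(1)[OF R S sw] by (simp add: cut_class_def)
  qed
  moreover have "finite ?Y"
    by (intro finite_SigmaI finite_cartesian_product finite_cut_class)
      (auto intro: finite_links regular_graphs_simple cut_class_regular)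
  ultimately have le: "card ?X \<le> card ?Y" by (rule card_inj_on_le)
  have "card (cut_class n d S j) * ((d * card S - j) * (d * (n - card S) - j - 2 * d\<^sup>2))
      = (\<Sum>E\<in>cut_class n d S j. (d * card S - j) * (d * (n - card S) - j - 2 * d\<^sup>2))"
    by (simp only: sum_constant of_nat_id)
  also have "\<dots> \<le> (\<Sum>E\<in>cut_class n d S j. card (switchings n S E))"
    by (rule sum_mono, rule card_switchings_ge[OF _ S]) (auto simp: cut_class_def)
  also have "\<dots> = card ?X"
    by (rule card_SigmaI[symmetric]) (auto intro: finite_cut_class fsw cut_class_regular)
  also note le
  also have "card ?Y = (\<Sum>E\<in>cut_class n d S (j + 2). card (?L E \<times> ?L E))"
    by (intro card_SigmaI)
      (auto intro: finite_cut_class finite_links regular_graphs_simple cut_class_regular)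
  also have "\<dots> = (\<Sum>E\<in>cut_class n d S (j + 2). (j + 2)\<^sup>2)"
    by (rule sum.cong) (auto simp: cut_class_def card_cartesian_product power2_eq_square)
  finally show ?thesis by (simp only: sum_constant of_nat_id)
qed

section \<open>Expansion of random regular graphs\<close>

definition expanding :: "nat \<Rightarrow> nat set set \<Rightarrow> bool" where
  "expanding n E \<longleftrightarrow>
     (\<forall>S\<subseteq>{..<n}. 2 * card S \<le> n \<longrightarrow> card S \<le> card (links S ({..<n} - S) E))"

text \<open>As long as the cut has at most \<open>5 * k\<close> edges, there are of order \<open>d * k\<close> choices for the edge
  inside \<open>S\<close> and \<open>d * n\<close> for the edge outside, against \<open>25 * k\<^sup>2\<close> ways back. So graphs whose
  cut has size \<open>j\<close> are rarer than those with cut size \<open>j + 2\<close> by a factor of order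
  \<open>k / (n * d\<^sup>2)\<close>.\<close>

lemma cut_class_ratio:
  assumes S: "S \<subseteq> {..<n}" and k: "card S = k" "0 < k" "2 * k \<le> n"
    and d: "20 \<le> d" and n: "16 * d \<le> n" and j: "j + 2 \<le> 5 * k"
  shows "real (card (cut_class n d S j))
       \<le> 200 * real k / (real n * (real d)\<^sup>2) * real (card (cut_class n d S (j + 2)))"
proof -
  let ?N = "\<lambda>j. card (cut_class n d S j)"
  have 1: "d * k \<le> 2 * (d * k - j)"
  proof -
    have "20 * k \<le> d * k" using d by simp
    then show ?thesis using j by linarith
  qed
  have 2: "d * n \<le> 4 * (d * (n - k) - j - 2 * d\<^sup>2)"
  proof -
    have "d * n \<le> d * (2 * (n - k))" using k by (intro mult_left_mono) auto
    then have a: "d * n \<le> 2 * (d * (n - k))" by (simp only: mult.left_commute)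
    \<comment> \<open>Of the at least \<open>d * n / 2\<close> oriented edges at the complement, the cut and the forbidden ones take at most an eighth of \<open>d * n\<close> each.\<close>
    have b: "16 * d\<^sup>2 \<le> d * n"
      using mult_left_mono[OF n, of d] by (simp add: power2_eq_square mult_ac)
    have c: "20 * n \<le> d * n" using d by simp
    have "8 * j \<le> d * n" using j k c by linarith
    then show ?thesis using a b by linarith
  qed
  have "?N j * ((d * k) * (d * n)) \<le> ?N j * ((2 * (d * k - j)) * (4 * (d * (n - k) - j - 2 * d\<^sup>2)))"
    by (intro mult_left_mono mult_mono 1 2) auto
  also have "\<dots> = 8 * (?N j * ((d * k - j) * (d * (n - k) - j - 2 * d\<^sup>2)))"
    by (simp only: mult_ac)
  also have "\<dots> \<le> 8 * (?N (j + 2) * (j + 2)\<^sup>2)"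
    using switching_double_count[OF S, of d j] k by (intro mult_left_mono) auto
  also have "\<dots> \<le> 8 * (?N (j + 2) * (5 * k)\<^sup>2)"
    using j by (intro mult_left_mono power_mono) auto
  finally have "?N j * ((d * k) * (d * n)) \<le> 8 * (?N (j + 2) * (5 * k)\<^sup>2)" .
  then have "real (?N j * ((d * k) * (d * n))) \<le> real (8 * (?N (j + 2) * (5 * k)\<^sup>2))"
    by (simp only: of_nat_le_iff)
  then have "real k * (real (?N j) * (real n * (real d)\<^sup>2)) \<le> real k * (200 * real k * real (?N (j + 2)))"
    by (simp add: power2_eq_square mult_ac)
  then have "real (?N j) * (real n * (real d)\<^sup>2) \<le> 200 * real k * real (?N (j + 2))"
    using k by simp
  moreover have "0 < real n * (real d)\<^sup>2" using d k by simp
  ultimately show ?thesis by (simp add: pos_le_divide_eq)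
qed

lemma cut_class_decay:
  assumes S: "S \<subseteq> {..<n}" and k: "card S = k" "0 < k" "2 * k \<le> n"
    and d: "20 \<le> d" and n: "16 * d \<le> n" and j: "j + 2 * t \<le> 5 * k"
  shows "real (card (cut_class n d S j))
       \<le> (200 * real k / (real n * (real d)\<^sup>2)) ^ t * real (card (cut_class n d S (j + 2 * t)))"
  using j
proof (induction t)
  case (Suc t)
  let ?r = "200 * real k / (real n * (real d)\<^sup>2)"
  have "real (card (cut_class n d S j)) \<le> ?r ^ t * real (card (cut_class n d S (j + 2 * t)))"
    using Suc by simp
  also have "\<dots> \<le> ?r ^ t * (?r * real (card (cut_class n d S (j + 2 * t + 2))))"
    using Suc.prems by (intro mult_left_mono cut_class_ratio[OF S k d n]) auto
  finally show ?case by (simp add: mult_ac)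
qed simp

text \<open>From a cut with fewer than \<open>k\<close> edges one can switch \<open>2 * k\<close> times before reaching \<open>5 * k\<close> edges.
  The exponent \<open>2 * k\<close> is what the union bound needs: the number of sets of size \<open>k\<close> is about
  \<open>(n / k) ^ k\<close>, so one factor \<open>(k / n) ^ k\<close> would only just compensate it.\<close>

lemma sparse_cut_count:
  assumes S: "S \<subseteq> {..<n}" and k: "card S = k" "0 < k" "2 * k \<le> n"
    and d: "20 \<le> d" and n: "16 * d \<le> n"
  shows "real (card {E \<in> regular_graphs n d. card (links S ({..<n} - S) E) < k})
       \<le> (200 * real k / (real n * (real d)\<^sup>2)) ^ (2 * k) * real (card (regular_graphs n d))"
proof -
  let ?r = "200 * real k / (real n * (real d)\<^sup>2)"
  let ?C = "cut_class n d S"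
  have disj: "card (\<Union>j\<in>{..<k}. ?C (f j)) = (\<Sum>j<k. card (?C (f j)))"
    if "inj f" for f :: "nat \<Rightarrow> nat"
    using that finite_cut_class by (intro card_UN_disjoint) (auto simp: cut_class_def inj_def)
  have "{E \<in> regular_graphs n d. card (links S ({..<n} - S) E) < k} = (\<Union>j\<in>{..<k}. ?C j)"
    by (auto simp: cut_class_def)
  then have "real (card {E \<in> regular_graphs n d. card (links S ({..<n} - S) E) < k})
      = (\<Sum>j<k. real (card (?C j)))"
    using disj[of "\<lambda>j. j"] by simp
  also have "\<dots> \<le> (\<Sum>j<k. ?r ^ (2 * k) * real (card (?C (j + 2 * (2 * k)))))"
    by (intro sum_mono cut_class_decay[OF S k d n]) auto
  also have "\<dots> = ?r ^ (2 * k) * real (card (\<Union>j\<in>{..<k}. ?C (j + 2 * (2 * k))))"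
    using disj[of "\<lambda>j. j + 2 * (2 * k)"] by (simp add: sum_distrib_left inj_def)
  also have "\<dots> \<le> ?r ^ (2 * k) * real (card (regular_graphs n d))"
    by (intro mult_left_mono of_nat_mono card_mono finite_regular_graphs)
      (auto simp: cut_class_def)
  finally show ?thesis .
qed

text \<open>The Poisson distribution with mean \<open>k\<close> gives the value \<open>k\<close> probability at most 1, which reads
  \<open>k ^ k \<le> exp k * fact k\<close>.\<close>

lemma power_self_le_fact: "real k ^ k \<le> 3 ^ k * fact k"
proof -
  have "real k ^ k / fact k * exp (- real k) \<le> 1" if "k > 0"
    using pmf_le_1[of "poisson_pmf (real k)" k] that by simp
  then have "real k ^ k \<le> exp (real k) * fact k" if "k > 0"
    using that by (simp add: exp_minus field_simps)
  moreover have "exp (real k) \<le> 3 ^ k"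
    using power_mono[OF exp_le, of k] by (simp add: exp_of_nat_mult[symmetric])
  ultimately show ?thesis
    by (cases "k = 0") (auto intro: order_trans mult_right_mono)
qed

text \<open>Up to constants the left-hand side is \<open>(n / k) ^ k * (k / (n * d\<^sup>2)) ^ (2 * k)\<close>, which is
  \<open>(k / n) ^ k\<close> times \<open>(c / d ^ 4) ^ k\<close> for a constant \<open>c\<close>. For \<open>d \<ge> 30\<close> the
  quotient \<open>c / d ^ 4\<close> is at most \<open>1 / 4\<close>. One factor \<open>k / n\<close> is kept to make the sum over \<open>k\<close> vanish as
  \<open>n\<close> grows, and its numerator is absorbed by \<open>2 ^ k\<close>.\<close>

lemma union_bound_term:
  assumes k: "0 < k" "k \<le> n" and d: "30 \<le> d"
  shows "real (n choose k) * (200 * real k / (real n * (real d)\<^sup>2)) ^ (2 * k) \<le> (1 / 2) ^ k / real n"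
proof -
  have n: "real n > 0" using k by simp
  let ?q = "real k / real n"
  have q: "0 \<le> ?q" "?q \<le> 1" using k by auto
  have ch: "real (n choose k) * ?q ^ k \<le> 3 ^ k"
  proof -
    have "real (n choose k) * fact k \<le> real n ^ k"
      using binomial_fact_pow[of n k] by (metis of_nat_fact of_nat_le_iff of_nat_mult of_nat_power)
    then have "real (n choose k) * fact k * real k ^ k \<le> real n ^ k * (3 ^ k * fact k)"
      using power_self_le_fact[of k] by (intro mult_mono) auto
    then have "fact k * (real (n choose k) * real k ^ k) \<le> fact k * (3 ^ k * real n ^ k)"
      by (simp add: mult_ac)
    then have "real (n choose k) * real k ^ k \<le> 3 ^ k * real n ^ k"
      by (rule mult_left_le_imp_le) simp
    then show ?thesis using n by (simp add: power_divide field_simps)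
  qed
  have c: "(200 / (real d)\<^sup>2)\<^sup>2 \<le> 1 / 12"
  proof -
    have "30\<^sup>2 \<le> (real d)\<^sup>2" using d by (intro power_mono) auto
    then have "200 / (real d)\<^sup>2 \<le> 200 / 30\<^sup>2"
      using d by (intro divide_left_mono) auto
    then have "(200 / (real d)\<^sup>2)\<^sup>2 \<le> (200 / 30\<^sup>2)\<^sup>2" by (intro power_mono) auto
    also have "\<dots> \<le> (1 / 12 :: real)" by (simp add: power2_eq_square)
    finally show ?thesis .
  qed
  have "real (n choose k) * (200 * real k / (real n * (real d)\<^sup>2)) ^ (2 * k)
      = (real (n choose k) * ?q ^ k) * ((200 / (real d)\<^sup>2)\<^sup>2 ^ k * ?q ^ k)"
  proof -
    have "(200 * real k / (real n * (real d)\<^sup>2)) = (200 / (real d)\<^sup>2) * ?q" by simp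
    then show ?thesis
      by (simp only: power_mult power_mult_distrib)
        (simp add: power2_eq_square power_mult_distrib power_divide mult_ac)
  qed
  also have "\<dots> \<le> 3 ^ k * ((1 / 12) ^ k * ?q ^ 1)"
    using k q c by (intro mult_mono ch power_mono power_decreasing) auto
  also have "\<dots> = (1 / 4) ^ k * ?q"
    by (simp add: power_mult_distrib[symmetric])
  also have "\<dots> \<le> (1 / 4) ^ k * (2 ^ k / real n)"
  proof -
    have "real k \<le> real (2 ^ k)" using less_exp[of k] by linarith
    then show ?thesis using n by (intro mult_left_mono divide_right_mono) auto
  qed
  also have "\<dots> = (1 / 2) ^ k / real n"
    by (simp add: power_mult_distrib[symmetric])
  finally show ?thesis .
qed

lemma nonexpanding_count:
  assumes d: "30 \<le> d" and n: "16 * d \<le> n"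
  shows "real (card {E \<in> regular_graphs n d. \<not> expanding n E})
       \<le> real (card (regular_graphs n d)) / real n"
proof -
  let ?R = "real (card (regular_graphs n d))"
  let ?bad = "\<lambda>S. {E \<in> regular_graphs n d. card (links S ({..<n} - S) E) < card S}"
  let ?K = "{1..n div 2}"
  let ?sub = "\<lambda>k. {S. S \<subseteq> {..<n} \<and> card S = k}"
  let ?g = "\<lambda>k. (200 * real k / (real n * (real d)\<^sup>2)) ^ (2 * k)"
  have fin: "finite (?bad S)" for S
    using finite_regular_graphs by simp
  have fsub: "finite (?sub k)" for k by (rule finite_subset[of _ "Pow {..<n}"]) auto
  have "{E \<in> regular_graphs n d. \<not> expanding n E} \<subseteq> (\<Union>k\<in>?K. \<Union>S\<in>?sub k. ?bad S)"
  proof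
    fix E assume "E \<in> {E \<in> regular_graphs n d. \<not> expanding n E}"
    then obtain S where S: "E \<in> regular_graphs n d" "S \<subseteq> {..<n}" "2 * card S \<le> n"
        "card (links S ({..<n} - S) E) < card S"
      by (auto simp: expanding_def not_le)
    then have "card S \<in> ?K" by auto
    then show "E \<in> (\<Union>k\<in>?K. \<Union>S\<in>?sub k. ?bad S)" using S by blast
  qed
  then have "card {E \<in> regular_graphs n d. \<not> expanding n E} \<le> card (\<Union>k\<in>?K. \<Union>S\<in>?sub k. ?bad S)"
    by (rule card_mono[rotated]) (auto intro: fin fsub)
  also have "\<dots> \<le> (\<Sum>k\<in>?K. card (\<Union>S\<in>?sub k. ?bad S))"
    by (rule card_UN_le) simp
  also have "\<dots> \<le> (\<Sum>k\<in>?K. \<Sum>S\<in>?sub k. card (?bad S))"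
    by (intro sum_mono card_UN_le fsub)
  finally have "real (card {E \<in> regular_graphs n d. \<not> expanding n E})
      \<le> (\<Sum>k\<in>?K. \<Sum>S\<in>?sub k. real (card (?bad S)))"
    by (simp only: of_nat_sum[symmetric] of_nat_le_iff)
  also have "\<dots> \<le> (\<Sum>k\<in>?K. \<Sum>S\<in>?sub k. ?g k * ?R)"
  proof (intro sum_mono)
    fix k S assume "k \<in> ?K" "S \<in> ?sub k"
    then show "real (card (?bad S)) \<le> ?g k * ?R"
      using sparse_cut_count[of S n k d] d n by auto
  qed
  also have "\<dots> = (\<Sum>k\<in>?K. real (n choose k) * ?g k * ?R)"
    using n_subsets[of "{..<n}"] by (simp add: mult_ac)
  also have "\<dots> \<le> (\<Sum>k\<in>?K. (1 / 2) ^ k / real n * ?R)"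
    using union_bound_term[of _ n d] d by (intro sum_mono mult_right_mono) auto
  also have "\<dots> = (\<Sum>k\<in>?K. (1 / 2) ^ k) * (?R / real n)"
    unfolding sum_distrib_right by simp
  also have "\<dots> \<le> 1 * (?R / real n)"
  proof (intro mult_right_mono)
    have "(\<Sum>k\<in>{1..m}. (1 / 2 :: real) ^ k) = 1 - (1 / 2) ^ m" for m
      by (induction m) auto
    then show "(\<Sum>k\<in>?K. (1 / 2 :: real) ^ k) \<le> 1" by simp
  qed simp
  finally show ?thesis by simp
qed

section \<open>Existence of regular graphs\<close>

definition circulant :: "nat \<Rightarrow> nat set \<Rightarrow> nat set set" where
  "circulant n C = {{v, (v + c) mod n} | v c. v < n \<and> c \<in> C}"

lemma circulant_regular:
  assumes C: "C \<subseteq> {0<..<n}" and sym: "\<And>c. c \<in> C \<Longrightarrow> n - c \<in> C"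
  shows "circulant n C \<in> regular_graphs n (card C)"
proof -
  have inj: "c = c'" if "c < n" "c' < n" "(v + c) mod n = (v + c') mod n" for v c c'
    using that
  proof (induction c c' rule: linorder_wlog)
    case (le c c')
    then have "n dvd (v + c') - (v + c)"
      by (subst mod_eq_dvd_iff_nat[symmetric]) auto
    then show ?case using le by (auto dest: dvd_imp_le)
  qed simp
  have neq: "(v + c) mod n \<noteq> v" if "v < n" "c \<in> C" for v c
    using inj[of c 0 v] that C by auto
  have simple: "circulant n C \<in> simple_graphs n"
    using neq by (fastforce simp: simple_graphs_def circulant_def)
  have "nbrs (circulant n C) v = (\<lambda>c. (v + c) mod n) ` C" if v: "v < n" for v
  proof
    show "(\<lambda>c. (v + c) mod n) ` C \<subseteq> nbrs (circulant n C) v"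
      using v by (auto simp: nbrs_def circulant_def)
    show "nbrs (circulant n C) v \<subseteq> (\<lambda>c. (v + c) mod n) ` C"
    proof
      fix u assume "u \<in> nbrs (circulant n C) v"
      then obtain w c where wc: "{v, u} = {w, (w + c) mod n}" "w < n" "c \<in> C"
        by (auto simp: nbrs_def circulant_def)
      then consider "w = v" "u = (v + c) mod n" | "w = u" "v = (u + c) mod n"
        by (auto simp: doubleton_eq_iff)
      then show "u \<in> (\<lambda>c. (v + c) mod n) ` C"
      proof cases
        case 2
        have "(v + (n - c)) mod n = (u + c + (n - c)) mod n"
          using 2 by (simp add: mod_add_left_eq)
        also have "\<dots> = u" using 2 wc C by auto
        finally show ?thesis using sym[OF wc(3)] by force
      qed (use wc in auto)
    qed
  qed
  moreover have "inj_on (\<lambda>c. (v + c) mod n) C" for v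
    by (rule inj_onI, rule inj[of _ _ v]) (use C in auto)
  ultimately have "card (nbrs (circulant n C) v) = card C" if "v < n" for v
    using that by (simp add: card_image)
  then show ?thesis using simple by (simp add: regular_graphs_def vertex_degree_eq_card_nbrs)
qed

text \<open>The uniform distribution on \<open>regular_graphs n d\<close> has a meaning only if this set is inhabited.
  Connecting each vertex of a cycle to the \<open>d div 2\<close> nearest ones on both sides, and to the antipode
  if \<open>d\<close> is odd (so that \<open>n\<close> is even), gives an element.\<close>

lemma regular_graphs_nonempty:
  assumes "d < n" "even (d * n)"
  shows "regular_graphs n d \<noteq> {}"
proof -
  define C where "C = {0<..d div 2} \<union> {n - d div 2..<n} \<union> (if odd d then {n div 2} else {})"
  have lt: "2 * (d div 2) < n" and n: "odd d \<Longrightarrow> even n" using assms by auto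
  have "C \<subseteq> {0<..<n}" using lt assms by (auto simp: C_def)
  moreover have "n - c \<in> C" if "c \<in> C" for c
    using that lt n by (auto simp: C_def elim!: evenE split: if_splits)
  moreover have "card C = d"
  proof -
    have "card ({0<..d div 2} \<union> {n - d div 2..<n}) = 2 * (d div 2)"
      using lt by (subst card_Un_disjoint) auto
    moreover have "n div 2 \<notin> {0<..d div 2} \<union> {n - d div 2..<n}" if "odd d"
      using that n assms by (auto elim!: evenE oddE)
    ultimately show ?thesis by (auto simp: C_def)
  qed
  ultimately show ?thesis using circulant_regular[of C n] by auto
qed

section \<open>A Poincare inequality for expanding graphs\<close>

text \<open>The total variation of \<open>f\<close> is the integral over \<open>t > 0\<close> of the cuts of the level sets \<open>{f > t}\<close>.
  All of them are contained in the support, hence small enough for the expansion hypothesis, and the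
  integral of their sizes is the sum of \<open>f\<close>. The induction peels off the lowest layer of \<open>f\<close>, that is
  its minimum on the support times the indicator of the support. The factor 2 appears because the
  sum runs over ordered pairs.\<close>

lemma coarea_inequality:
  fixes f :: "nat \<Rightarrow> real" and a :: "nat \<Rightarrow> nat \<Rightarrow> real"
  assumes a0: "\<And>u v. 0 \<le> a u v" and sym: "\<And>u v. a u v = a v u"
    and cut: "\<And>S. S \<subseteq> {..<n} \<Longrightarrow> 2 * card S \<le> n \<Longrightarrow> real (card S) \<le> (\<Sum>u\<in>S. \<Sum>v\<in>{..<n} - S. a u v)"
    and f0: "\<And>v. 0 \<le> f v" and supp: "2 * card {v. v < n \<and> f v \<noteq> 0} \<le> n"
  shows "2 * (\<Sum>v<n. f v) \<le> (\<Sum>u<n. \<Sum>v<n. a u v * \<bar>f u - f v\<bar>)"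
  using f0 supp
proof (induction "card {v. v < n \<and> f v \<noteq> 0}" arbitrary: f rule: less_induct)
  case less
  define S where "S = {v. v < n \<and> f v \<noteq> 0}"
  have S: "S \<subseteq> {..<n}" "finite S" "2 * card S \<le> n" using less.prems by (auto simp: S_def)
  show ?case
  proof (cases "S = {}")
    case True
    then have "f v = 0" if "v < n" for v using that by (auto simp: S_def)
    then show ?thesis using a0 by (auto intro!: sum_nonneg)
  next
    case False
    define m where "m = Min (f ` S)"
    have "m \<in> f ` S" unfolding m_def using False S by (intro Min_in) auto
    then obtain w where w: "w \<in> S" "f w = m" by auto
    have le: "m \<le> f v" if "v \<in> S" for v unfolding m_def using that S by (intro Min_le) auto
    have m: "m > 0" using w less.prems(1)[of w] by (auto simp: S_def)
    define g where "g v = (if v \<in> S then f v - m else 0)" for v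
    define h where "h v = (if v \<in> S then m else 0)" for v
    have fgh: "f v = g v + h v" if "v < n" for v
      using that by (auto simp: g_def h_def S_def)
    have sub: "{v. v < n \<and> g v \<noteq> 0} \<subset> S"
      using w S by (auto simp: g_def)
    then have lt: "card {v. v < n \<and> g v \<noteq> 0} < card S" using S by (intro psubset_card_mono) auto
    have IH: "2 * (\<Sum>v<n. g v) \<le> (\<Sum>u<n. \<Sum>v<n. a u v * \<bar>g u - g v\<bar>)"
    proof (rule less.hyps)
      show "card {v. v < n \<and> g v \<noteq> 0} < card {v. v < n \<and> f v \<noteq> 0}" using lt by (simp add: S_def)
      show "0 \<le> g v" for v using le by (auto simp: g_def)
      show "2 * card {v. v < n \<and> g v \<noteq> 0} \<le> n" using lt S by simp
    qed
    have step: "\<bar>f u - f v\<bar> = \<bar>g u - g v\<bar> + \<bar>h u - h v\<bar>" if "u < n" "v < n" for u v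
    proof -
      have "f v = 0" if "v < n" "v \<notin> S" for v using that by (simp add: S_def)
      then show ?thesis
        using that le[of u] le[of v] m by (cases "u \<in> S"; cases "v \<in> S") (auto simp: g_def h_def)
    qed
    have lvl: "(\<Sum>u<n. \<Sum>v<n. a u v * \<bar>h u - h v\<bar>) \<ge> 2 * (\<Sum>v<n. h v)"
    proof -
      let ?T = "{..<n} - S"
      have split: "(\<Sum>v<n. F v) = (\<Sum>v\<in>S. F v) + (\<Sum>v\<in>?T. F v)" for F :: "nat \<Rightarrow> real"
        using S by (simp add: sum.subset_diff add.commute)
      have "(\<Sum>u<n. \<Sum>v<n. a u v * \<bar>h u - h v\<bar>)
          = (\<Sum>u\<in>S. \<Sum>v\<in>?T. a u v * m) + (\<Sum>u\<in>?T. \<Sum>v\<in>S. a u v * m)"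
        unfolding split using m by (simp add: h_def)
      also have "(\<Sum>u\<in>?T. \<Sum>v\<in>S. a u v * m) = (\<Sum>u\<in>S. \<Sum>v\<in>?T. a u v * m)"
        by (subst sum.swap) (simp add: sym)
      finally have "(\<Sum>u<n. \<Sum>v<n. a u v * \<bar>h u - h v\<bar>) = 2 * m * (\<Sum>u\<in>S. \<Sum>v\<in>?T. a u v)"
        by (simp add: sum_distrib_left mult_ac)
      also have "\<dots> \<ge> 2 * m * real (card S)"
        using cut[OF S(1,3)] m by (intro mult_left_mono) auto
      finally show ?thesis unfolding split by (simp add: h_def mult_ac)
    qed
    have "2 * (\<Sum>v<n. f v) = 2 * (\<Sum>v<n. g v) + 2 * (\<Sum>v<n. h v)"
      by (simp add: fgh sum.distrib)
    also have "\<dots> \<le> (\<Sum>u<n. \<Sum>v<n. a u v * \<bar>g u - g v\<bar>) + (\<Sum>u<n. \<Sum>v<n. a u v * \<bar>h u - h v\<bar>)"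
      using IH lvl by linarith
    also have "\<dots> = (\<Sum>u<n. \<Sum>v<n. a u v * \<bar>f u - f v\<bar>)"
      by (simp add: step sum.distrib distrib_left)
    finally show ?thesis .
  qed
qed

lemma median_exists:
  fixes x :: "nat \<Rightarrow> real"
  assumes "0 < n"
  obtains m where "2 * card {v. v < n \<and> m < x v} \<le> n" "2 * card {v. v < n \<and> x v < m} \<le> n"
proof -
  let ?up = "\<lambda>m. {v. v < n \<and> m < x v}"
  define Q where "Q = {m \<in> x ` {..<n}. 2 * card (?up m) \<le> n}"
  define M where "M = Max (x ` {..<n})"
  have "x v \<le> M" if "v < n" for v unfolding M_def using that by (intro Max_ge) auto
  then have "?up M = {}" by fastforce
  then have "2 * card (?up M) \<le> n" by (simp only: card.empty)
  moreover have "M \<in> x ` {..<n}" unfolding M_def using assms by (intro Max_in) auto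
  ultimately have "M \<in> Q" by (simp add: Q_def)
  moreover have finQ: "finite Q" unfolding Q_def by auto
  ultimately have mQ: "Min Q \<in> Q" by (intro Min_in) auto
  define m where "m = Min Q"
  have "2 * card {v. v < n \<and> x v < m} \<le> n"
  proof (cases "{v. v < n \<and> x v < m} = {}")
    case False
    let ?L = "{v. v < n \<and> x v < m}"
    \<comment> \<open>The largest value below \<open>m\<close>: more than half of the values exceed it, hence fewer than half lie below \<open>m\<close>.\<close>
    define w where "w = Max (x ` ?L)"
    have "w \<in> x ` ?L" unfolding w_def using False by (intro Max_in) auto
    moreover have le: "x v \<le> w" if "v \<in> ?L" for v unfolding w_def using that by (intro Max_ge) auto
    ultimately have w: "w \<in> x ` {..<n}" "w < m" by auto
    have "w \<notin> Q" using w Min_le[OF finQ, of w] by (auto simp: m_def)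
    then have "n < 2 * card (?up w)" using w by (auto simp: Q_def)
    moreover have "card (?up w) + card ?L = card (?up w \<union> ?L)"
      using le by (intro card_Un_disjoint[symmetric]) force+
    moreover have "card (?up w \<union> ?L) \<le> card {..<n}" by (intro card_mono) auto
    ultimately show ?thesis by simp
  next
    case True
    then show ?thesis by (simp only: card.empty)
  qed
  then show thesis using that[of m] mQ by (auto simp: Q_def m_def)
qed

text \<open>This is the argument behind Cheeger's inequality. The coarea inequality is applied to the squares of the
  positive and of the negative part of \<open>z\<close>, both of which have small support. The resulting
  differences of squares factor as \<open>\<bar>z u - z v\<bar> * (\<bar>z u\<bar> + \<bar>z v\<bar>)\<close>; a weighted
  arithmetic-geometric mean inequality turns the first factor into the energy and the second into
  half of what the left-hand side provides, where it can be absorbed.\<close>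

lemma poincare_from_expansion:
  fixes z :: "nat \<Rightarrow> real" and a :: "nat \<Rightarrow> nat \<Rightarrow> real"
  assumes a0: "\<And>u v. 0 \<le> a u v" and sym: "\<And>u v. a u v = a v u"
    and deg: "\<And>u. u < n \<Longrightarrow> (\<Sum>v<n. a u v) = D" and D: "0 < D"
    and cut: "\<And>S. S \<subseteq> {..<n} \<Longrightarrow> 2 * card S \<le> n \<Longrightarrow> real (card S) \<le> (\<Sum>u\<in>S. \<Sum>v\<in>{..<n} - S. a u v)"
    and pos: "2 * card {v. v < n \<and> 0 < z v} \<le> n" and neg: "2 * card {v. v < n \<and> z v < 0} \<le> n"
  shows "(\<Sum>v<n. (z v)\<^sup>2) \<le> D * (\<Sum>u<n. \<Sum>v<n. a u v * (z u - z v)\<^sup>2)"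
proof -
  define p where "p v = (max (z v) 0)\<^sup>2" for v
  define q where "q v = (max (- z v) 0)\<^sup>2" for v
  let ?Z = "\<Sum>v<n. (z v)\<^sup>2" and ?P = "\<Sum>u<n. \<Sum>v<n. a u v * (z u - z v)\<^sup>2"
  have pq: "(z v)\<^sup>2 = p v + q v" for v by (auto simp: p_def q_def max_def)
  have sp: "{v. v < n \<and> p v \<noteq> 0} = {v. v < n \<and> 0 < z v}"
    by (auto simp: p_def max_def)
  have sq: "{v. v < n \<and> q v \<noteq> 0} = {v. v < n \<and> z v < 0}"
    by (auto simp: q_def max_def)
  have dif: "\<bar>p u - p v\<bar> + \<bar>q u - q v\<bar> \<le> D * (z u - z v)\<^sup>2 + ((z u)\<^sup>2 + (z v)\<^sup>2) / (2 * D)" for u v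
  proof -
    have "\<bar>p u - p v\<bar> + \<bar>q u - q v\<bar> \<le> \<bar>z u - z v\<bar> * (\<bar>z u\<bar> + \<bar>z v\<bar>)"
    proof -
      have sqd: "\<bar>x\<^sup>2 - y\<^sup>2\<bar> = \<bar>x - y\<bar> * (\<bar>x\<bar> + \<bar>y\<bar>)" if "0 \<le> x * y" for x y :: real
      proof -
        have "\<bar>x\<^sup>2 - y\<^sup>2\<bar> = \<bar>x - y\<bar> * \<bar>x + y\<bar>"
          by (simp add: abs_mult[symmetric] power2_eq_square algebra_simps)
        moreover have "\<bar>x + y\<bar> = \<bar>x\<bar> + \<bar>y\<bar>" using that by (auto simp: zero_le_mult_iff)
        ultimately show ?thesis by simp
      qed
      have opp: "x\<^sup>2 + y\<^sup>2 \<le> \<bar>x - y\<bar> * (\<bar>x\<bar> + \<bar>y\<bar>)" if "x * y \<le> 0" for x y :: real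
      proof -
        have "\<bar>x - y\<bar> = \<bar>x\<bar> + \<bar>y\<bar>" using that by (auto simp: mult_le_0_iff)
        then have "\<bar>x - y\<bar> * (\<bar>x\<bar> + \<bar>y\<bar>) = x\<^sup>2 + y\<^sup>2 + 2 * (\<bar>x\<bar> * \<bar>y\<bar>)"
          by (simp add: power2_eq_square algebra_simps)
        then show ?thesis by simp
      qed
      show ?thesis
        using sqd[of "z u" "z v"] opp[of "z u" "z v"]
        by (cases "0 \<le> z u"; cases "0 \<le> z v")
          (auto simp: p_def q_def max_def mult_le_0_iff zero_le_mult_iff)
    qed
    also have "\<dots> \<le> D * (z u - z v)\<^sup>2 + (\<bar>z u\<bar> + \<bar>z v\<bar>)\<^sup>2 / (4 * D)"
    proof -
      have amgm: "s * t \<le> D * s\<^sup>2 + t\<^sup>2 / (4 * D)" for s t :: real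
      proof -
        have "0 \<le> (2 * D * s - t)\<^sup>2 / (4 * D)" using D by simp
        also have "\<dots> = D * s\<^sup>2 + t\<^sup>2 / (4 * D) - s * t"
          using D by (simp add: power2_eq_square field_simps)
        finally show ?thesis by simp
      qed
      show ?thesis using amgm[of "\<bar>z u - z v\<bar>"] by simp
    qed
    also have "(\<bar>z u\<bar> + \<bar>z v\<bar>)\<^sup>2 / (4 * D) \<le> (2 * ((z u)\<^sup>2 + (z v)\<^sup>2)) / (4 * D)"
    proof (rule divide_right_mono)
      have "0 \<le> (\<bar>z u\<bar> - \<bar>z v\<bar>)\<^sup>2" by simp
      then show "(\<bar>z u\<bar> + \<bar>z v\<bar>)\<^sup>2 \<le> 2 * ((z u)\<^sup>2 + (z v)\<^sup>2)"
        by (simp add: power2_sum power2_diff)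
    qed (use D in simp)
    also have "(2 * ((z u)\<^sup>2 + (z v)\<^sup>2)) / (4 * D) = ((z u)\<^sup>2 + (z v)\<^sup>2) / (2 * D)"
      using D by (simp add: divide_simps)
    finally show ?thesis by simp
  qed
  have "2 * ?Z = 2 * (\<Sum>v<n. p v) + 2 * (\<Sum>v<n. q v)"
    by (simp add: pq sum.distrib)
  also have "\<dots> \<le> (\<Sum>u<n. \<Sum>v<n. a u v * \<bar>p u - p v\<bar>) + (\<Sum>u<n. \<Sum>v<n. a u v * \<bar>q u - q v\<bar>)"
    by (intro add_mono coarea_inequality a0 sym cut)
      (simp_all add: sp sq pos neg, simp_all add: p_def q_def)
  also have "\<dots> = (\<Sum>u<n. \<Sum>v<n. a u v * (\<bar>p u - p v\<bar> + \<bar>q u - q v\<bar>))"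
    by (simp add: distrib_left sum.distrib)
  also have "\<dots> \<le> (\<Sum>u<n. \<Sum>v<n. a u v * (D * (z u - z v)\<^sup>2 + ((z u)\<^sup>2 + (z v)\<^sup>2) / (2 * D)))"
    by (intro sum_mono mult_left_mono dif a0)
  also have "\<dots> = D * ?P + ((\<Sum>u<n. \<Sum>v<n. a u v * (z u)\<^sup>2) + (\<Sum>u<n. \<Sum>v<n. a u v * (z v)\<^sup>2)) / (2 * D)"
    by (simp add: distrib_left sum.distrib sum_distrib_left sum_divide_distrib mult_ac add_divide_distrib)
  also have "(\<Sum>u<n. \<Sum>v<n. a u v * (z v)\<^sup>2) = (\<Sum>u<n. \<Sum>v<n. a u v * (z u)\<^sup>2)"
    by (subst sum.swap) (simp add: sym)
  also have "(\<Sum>u<n. \<Sum>v<n. a u v * (z u)\<^sup>2) = D * ?Z"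
    by (simp add: sum_distrib_right[symmetric] deg sum_distrib_left)
  finally show ?thesis using D by (simp add: field_simps)
qed

text \<open>Subtracting a median \<open>m\<close> of \<open>x\<close> makes the previous inequality applicable without changing the
  energy. Since \<open>x\<close> vanishes at \<open>s\<close>, the term of \<open>s\<close> alone shows that \<open>m\<^sup>2\<close> is at most
  \<open>\<Sum>v<n. (x v - m)\<^sup>2\<close>. Adding the constant back therefore costs no more than a factor of order \<open>n\<close>,
  which is where the \<open>1 / n\<close> of the theorem comes from.\<close>

lemma grounded_poincare:
  fixes x :: "nat \<Rightarrow> real" and a :: "nat \<Rightarrow> nat \<Rightarrow> real"
  assumes a0: "\<And>u v. 0 \<le> a u v" and sym: "\<And>u v. a u v = a v u"
    and deg: "\<And>u. u < n \<Longrightarrow> (\<Sum>v<n. a u v) = D" and D: "0 < D"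
    and cut: "\<And>S. S \<subseteq> {..<n} \<Longrightarrow> 2 * card S \<le> n \<Longrightarrow> real (card S) \<le> (\<Sum>u\<in>S. \<Sum>v\<in>{..<n} - S. a u v)"
    and s: "s < n" "x s = 0"
  shows "(\<Sum>v<n. (x v)\<^sup>2) \<le> 4 * real n * D * (\<Sum>u<n. \<Sum>v<n. a u v * (x u - x v)\<^sup>2)"
proof -
  obtain m where m: "2 * card {v. v < n \<and> m < x v} \<le> n" "2 * card {v. v < n \<and> x v < m} \<le> n"
    using median_exists[of n x] s by auto
  let ?Z = "\<Sum>v<n. (x v - m)\<^sup>2" and ?P = "\<Sum>u<n. \<Sum>v<n. a u v * (x u - x v)\<^sup>2"
  have Z: "?Z \<le> D * ?P"
    using poincare_from_expansion[OF a0 sym deg D cut, of "\<lambda>v. x v - m"] m by simp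
  have "(x s - m)\<^sup>2 \<le> ?Z" using s by (intro member_le_sum) auto
  then have m2: "m\<^sup>2 \<le> ?Z" using s by simp
  have "(\<Sum>v<n. (x v)\<^sup>2) \<le> (\<Sum>v<n. 2 * (x v - m)\<^sup>2 + 2 * m\<^sup>2)"
  proof (rule sum_mono)
    fix v
    have "0 \<le> (x v - 2 * m)\<^sup>2" by simp
    then show "(x v)\<^sup>2 \<le> 2 * (x v - m)\<^sup>2 + 2 * m\<^sup>2"
      by (simp add: power2_eq_square algebra_simps)
  qed
  also have "\<dots> = 2 * ?Z + 2 * real n * m\<^sup>2" by (simp add: sum.distrib sum_distrib_left)
  also have "\<dots> \<le> 2 * real n * ?Z + 2 * real n * ?Z"
  proof (rule add_mono)
    have "0 \<le> ?Z" by (intro sum_nonneg) simp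
    then show "2 * ?Z \<le> 2 * real n * ?Z" using s by (intro mult_right_mono) auto
  qed (use m2 in \<open>intro mult_left_mono; simp\<close>)
  also have "\<dots> = 4 * real n * ?Z" by simp
  also have "\<dots> \<le> 4 * real n * (D * ?P)" using Z by (intro mult_left_mono) auto
  finally show ?thesis by (simp add: mult_ac)
qed

section \<open>The Rayleigh quotient of a symmetric matrix\<close>

lemma linear_term_zero:
  fixes g c :: real
  assumes "\<And>t. 0 \<le> 2 * t * g + t\<^sup>2 * c"
  shows "g = 0"
proof (rule ccontr)
  assume g: "g \<noteq> 0"
  \<comment> \<open>At \<open>t = - g / C\<close> the negative linear term outweighs the quadratic one.\<close>
  define C where "C = \<bar>c\<bar> + 1"
  have C: "C > 0" "c < C" by (auto simp: C_def)
  have "0 \<le> 2 * (- g / C) * g + (- g / C)\<^sup>2 * c" by (rule assms)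
  also have "\<dots> = (g / C)\<^sup>2 * (c - 2 * C)"
    using C by (simp add: power2_eq_square field_simps)
  also have "\<dots> < 0" using g C by (intro mult_pos_neg) auto
  finally show False by simp
qed

text \<open>The Rayleigh quotient of a symmetric matrix attains its minimum \<open>\<mu>\<close> by compactness of the unit
  sphere, and the first variation at a minimizer is the eigenvalue equation. Vectors are functions on
  \<open>nat\<close> so that the dimension can vary; the sphere is compact in the product topology once the
  coordinates from \<open>m\<close> on are fixed to be 0.\<close>

lemma rayleigh_minimizer:
  fixes b :: "nat \<Rightarrow> nat \<Rightarrow> real"
  assumes m: "0 < m" and sym: "\<And>i j. i < m \<Longrightarrow> j < m \<Longrightarrow> b i j = b j i"
  obtains x \<mu> where "(\<Sum>i<m. (x i)\<^sup>2) = 1"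
    and "\<And>i. i < m \<Longrightarrow> (\<Sum>j<m. b i j * x j) = \<mu> * x i"
    and "\<And>y. \<mu> * (\<Sum>i<m. (y i)\<^sup>2) \<le> (\<Sum>i<m. \<Sum>j<m. b i j * (y i * y j))"
proof -
  define N where "N x = (\<Sum>i<m. (x i)\<^sup>2)" for x :: "nat \<Rightarrow> real"
  define Q where "Q x = (\<Sum>i<m. \<Sum>j<m. b i j * (x i * x j))" for x :: "nat \<Rightarrow> real"
  define K where "K = (PiE UNIV (\<lambda>i. if i < m then {-1..1} else {0}) :: (nat \<Rightarrow> real) set)"
  have coord: "continuous_on UNIV (\<lambda>x :: nat \<Rightarrow> real. x i)" for i
    by simp
  have contN: "continuous_on UNIV N" and contQ: "continuous_on UNIV Q"
    unfolding N_def Q_def by (intro continuous_intros coord)+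
  have "compactin (product_topology (\<lambda>i. euclidean) UNIV) K"
    unfolding K_def by (subst compactin_PiE) auto
  then have "compact K" by (simp add: euclidean_product_topology)
  moreover have "closed {x. N x = 1}"
    using closed_Collect_eq[OF contN continuous_on_const] .
  ultimately have comp: "compact (K \<inter> {x. N x = 1})" by (rule compact_Int_closed)
  have in_K: "(\<lambda>i. if i < m then x i else 0) \<in> K" if "N x = 1" for x
  proof -
    have "\<bar>x i\<bar> \<le> 1" if "i < m" for i
    proof -
      have "(x i)\<^sup>2 \<le> N x" unfolding N_def using that by (intro member_le_sum) auto
      then show ?thesis using \<open>N x = 1\<close> by (simp add: abs_square_le_1)
    qed
    then show ?thesis by (auto simp: K_def PiE_iff abs_le_iff)
  qed
  have trunc: "N (\<lambda>i. if i < m then x i else 0) = N x" "Q (\<lambda>i. if i < m then x i else 0) = Q x" for x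
    by (auto simp: N_def Q_def intro!: sum.cong)
  define e0 where "e0 i = (if i = 0 then 1 else 0 :: real)" for i :: nat
  have e0: "N e0 = 1"
    unfolding N_def e0_def using m by (subst sum.remove[of _ 0]) auto
  have "(\<lambda>i. if i < m then e0 i else 0) \<in> K \<inter> {x. N x = 1}"
    using in_K[OF e0] trunc(1)[of e0] e0 by simp
  then have ne: "K \<inter> {x. N x = 1} \<noteq> {}" by blast
  obtain x where x: "x \<in> K \<inter> {x. N x = 1}" and min: "\<And>y. y \<in> K \<inter> {x. N x = 1} \<Longrightarrow> Q x \<le> Q y"
    using continuous_attains_inf[OF comp ne continuous_on_subset[OF contQ]] by auto
  define \<mu> where "\<mu> = Q x"
  have ray: "\<mu> * N y \<le> Q y" for y
  proof (cases "N y = 0")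
    case True
    then have "y i = 0" if "i < m" for i
      using that by (simp add: N_def sum_nonneg_eq_0_iff)
    then show ?thesis using True by (simp add: Q_def)
  next
    case False
    have "0 \<le> N y" by (simp add: N_def sum_nonneg)
    with False have pos: "0 < N y" by simp
    define z where "z i = y i / sqrt (N y)" for i
    have "N z = N y / N y"
      unfolding N_def z_def using pos by (simp add: N_def power_divide sum_divide_distrib[symmetric])
    then have Nz: "N z = 1" using pos by simp
    have "Q z = Q y / N y"
      using pos by (simp add: Q_def z_def sum_divide_distrib)
    moreover have "\<mu> \<le> Q z"
      using min[of "\<lambda>i. if i < m then z i else 0"] in_K[OF Nz] Nz by (simp add: trunc \<mu>_def)
    ultimately show ?thesis using pos by (simp add: pos_le_divide_eq)
  qed
  have ev: "(\<Sum>j<m. b i j * x j) = \<mu> * x i" if i: "i < m" for i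
  proof -
    define e where "e j = (if j = i then 1 else 0 :: real)" for j
    have pick: "(\<Sum>j<m. F j * e j) = F i" for F
      using i by (simp add: e_def if_distrib[of "\<lambda>c. _ * c"] cong: if_cong)
    let ?g = "(\<Sum>j<m. b i j * x j) - \<mu> * x i"
    \<comment> \<open>This is the quadratic form minus \<open>\<mu>\<close> times the squared norm at \<open>x + t * e\<close>, which vanishes for \<open>t = 0\<close>.\<close>
    have "0 \<le> 2 * t * ?g + t\<^sup>2 * (b i i - \<mu>)" for t
    proof -
      have "N (\<lambda>j. x j + t * e j) = N x + 2 * t * (\<Sum>j<m. x j * e j) + t\<^sup>2 * (\<Sum>j<m. e j * e j)"
        by (simp add: N_def power2_eq_square algebra_simps sum.distrib sum_distrib_left)
      then have 1: "N (\<lambda>j. x j + t * e j) = 1 + 2 * t * x i + t\<^sup>2"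
        using x by (simp only: pick) (simp add: e_def)
      have "Q (\<lambda>j. x j + t * e j) = Q x + t * (\<Sum>k<m. \<Sum>j<m. b k j * x k * e j)
          + t * (\<Sum>k<m. (\<Sum>j<m. b k j * x j) * e k) + t\<^sup>2 * (\<Sum>k<m. (\<Sum>j<m. b k j * e j) * e k)"
        by (simp add: Q_def power2_eq_square algebra_simps sum.distrib sum_distrib_left sum_distrib_right)
      also have "\<dots> = Q x + t * (\<Sum>k<m. b k i * x k) + t * (\<Sum>j<m. b i j * x j) + t\<^sup>2 * b i i"
        by (simp only: pick)
      also have "(\<Sum>k<m. b k i * x k) = (\<Sum>k<m. b i k * x k)"
        using sym i by (intro sum.cong) auto
      finally have 2: "Q (\<lambda>j. x j + t * e j) = \<mu> + 2 * t * (\<Sum>j<m. b i j * x j) + t\<^sup>2 * b i i"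
        by (simp add: \<mu>_def)
      show ?thesis using ray[of "\<lambda>j. x j + t * e j"] unfolding 1 2 by (simp add: algebra_simps)
    qed
    then have "?g = 0" by (rule linear_term_zero)
    then show ?thesis by simp
  qed
  show thesis
  proof (rule that[of x \<mu>])
    show "(\<Sum>i<m. (x i)\<^sup>2) = 1" using x by (simp add: N_def)
    show "\<mu> * (\<Sum>i<m. (y i)\<^sup>2) \<le> (\<Sum>i<m. \<Sum>j<m. b i j * (y i * y j))" for y
      using ray[of y] by (simp add: N_def Q_def)
  qed (rule ev)
qed

lemma smallest_eigenvalue_rayleigh:
  assumes A: "A \<in> carrier_mat m m" and m: "0 < m"
    and sym: "\<And>i j. i < m \<Longrightarrow> j < m \<Longrightarrow> A $$ (i, j) = A $$ (j, i)"
  shows "\<exists>x. (\<Sum>i<m. (x i)\<^sup>2) = 1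
      \<and> (\<Sum>i<m. \<Sum>j<m. A $$ (i, j) * (x i * x j)) = smallest_eigenvalue A"
    and "smallest_eigenvalue A * (\<Sum>i<m. (y i)\<^sup>2) \<le> (\<Sum>i<m. \<Sum>j<m. A $$ (i, j) * (y i * y j))"
proof -
  obtain x \<mu> where x: "(\<Sum>i<m. (x i)\<^sup>2) = 1"
    and ev: "\<And>i. i < m \<Longrightarrow> (\<Sum>j<m. A $$ (i, j) * x j) = \<mu> * x i"
    and ray: "\<And>y. \<mu> * (\<Sum>i<m. (y i)\<^sup>2) \<le> (\<Sum>i<m. \<Sum>j<m. A $$ (i, j) * (y i * y j))"
    using rayleigh_minimizer[OF m, of "\<lambda>i j. A $$ (i, j)"] sym by blast
  have form: "(\<Sum>i<m. \<Sum>j<m. A $$ (i, j) * (w i * w j)) = k * (\<Sum>i<m. (w i)\<^sup>2)"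
    if "\<And>i. i < m \<Longrightarrow> (\<Sum>j<m. A $$ (i, j) * w j) = k * w i" for w k
  proof -
    have "(\<Sum>i<m. \<Sum>j<m. A $$ (i, j) * (w i * w j)) = (\<Sum>i<m. w i * (\<Sum>j<m. A $$ (i, j) * w j))"
      by (simp add: sum_distrib_left mult_ac)
    also have "\<dots> = (\<Sum>i<m. w i * (k * w i))"
      using that by (intro sum.cong) auto
    finally show ?thesis by (simp add: sum_distrib_left power2_eq_square mult_ac)
  qed
  have mulv: "(A *\<^sub>v v) $ i = (\<Sum>j<m. A $$ (i, j) * v $ j)" if "v \<in> carrier_vec m" "i < m" for v i
    using A that by (auto simp: scalar_prod_def lessThan_atLeast0 intro!: sum.cong)
  have "smallest_eigenvalue A = \<mu>"
    unfolding smallest_eigenvalue_def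
  proof (rule Min_eqI)
    show "finite (spectrum A)" using card_finite_spectrum(1)[OF A] .
    have "Matrix.vec m x \<noteq> 0\<^sub>v m"
    proof
      assume "Matrix.vec m x = 0\<^sub>v m"
      then have "x i = 0" if "i < m" for i
        using that by (metis index_vec index_zero_vec(1))
      then show False using x by simp
    qed
    moreover have "A *\<^sub>v Matrix.vec m x = \<mu> \<cdot>\<^sub>v Matrix.vec m x"
      using A mulv ev by (intro eq_vecI) (auto simp del: index_mult_mat_vec)
    ultimately have "eigenvector A (Matrix.vec m x) \<mu>"
      using A by (simp add: eigenvector_def)
    then show "\<mu> \<in> spectrum A" by (auto simp: spectrum_def eigenvalue_def)
  next
    fix k assume "k \<in> spectrum A"
    then obtain v where v: "v \<in> carrier_vec m" "v \<noteq> 0\<^sub>v m" "A *\<^sub>v v = k \<cdot>\<^sub>v v"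
      using A by (auto simp: spectrum_def eigenvalue_def eigenvector_def)
    have "(\<Sum>j<m. A $$ (i, j) * v $ j) = k * v $ i" if "i < m" for i
      using mulv[OF v(1) that] v that by simp
    then have le: "\<mu> * (\<Sum>i<m. (v $ i)\<^sup>2) \<le> k * (\<Sum>i<m. (v $ i)\<^sup>2)"
      using ray[of "\<lambda>i. v $ i"] form[of "\<lambda>i. v $ i" k] by simp
    obtain i where "i < m" "v $ i \<noteq> 0"
      using v(1,2) by (metis eq_vecI carrier_vecD index_zero_vec)
    then have "0 < (\<Sum>i<m. (v $ i)\<^sup>2)" by (intro sum_pos2[of _ i]) auto
    then show "\<mu> \<le> k" using le by simp
  qed
  then show "\<exists>x. (\<Sum>i<m. (x i)\<^sup>2) = 1
      \<and> (\<Sum>i<m. \<Sum>j<m. A $$ (i, j) * (x i * x j)) = smallest_eigenvalue A"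
    and "smallest_eigenvalue A * (\<Sum>i<m. (y i)\<^sup>2) \<le> (\<Sum>i<m. \<Sum>j<m. A $$ (i, j) * (y i * y j))"
    using x form[OF ev] ray by auto
qed

section \<open>The grounded Laplacian of a regular graph\<close>

lemma sum_insert_index:
  assumes "s < n"
  shows "(\<Sum>i<n - 1. F (insert_index s i)) = (\<Sum>v\<in>{..<n} - {s}. F v)"
  by (rule sum.reindex_bij_witness[of _ "delete_index s" "insert_index s"])
    (use assms in \<open>auto simp: insert_index_def delete_index_def split: if_splits\<close>)

lemma adjacency_row_sum:
  assumes "E \<in> regular_graphs n d" "u < n"
  shows "(\<Sum>v<n. if {u, v} \<in> E then 1 else 0 :: real) = real d"
proof -
  have "(\<Sum>v<n. if {u, v} \<in> E then 1 else 0 :: real) = real (card ({..<n} \<inter> nbrs E u))"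
    by (simp add: sum.If_cases nbrs_def)
  also have "{..<n} \<inter> nbrs E u = nbrs E u"
    using nbrs_subset[OF regular_graphs_simple[OF assms(1)]] by blast
  finally show ?thesis using card_nbrs_regular[OF assms] by simp
qed

text \<open>Deleting the row and column of \<open>s\<close> means evaluating the quadratic form of the Laplacian on
  functions that vanish at \<open>s\<close>. In this form the energy of the preceding inequalities appears; each edge is
  counted in both directions, whence the division by 2.\<close>

lemma grounded_laplacian_form:
  fixes x :: "nat \<Rightarrow> real"
  assumes E: "E \<in> regular_graphs n d" and s: "s < n" and x: "x s = 0"
  defines "a \<equiv> \<lambda>u v. if {u, v} \<in> E then 1 else 0 :: real"
  shows "(\<Sum>i<n - 1. \<Sum>j<n - 1. grounded_laplacian n E s $$ (i, j)
            * (x (insert_index s i) * x (insert_index s j)))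
       = (\<Sum>u<n. \<Sum>v<n. a u v * (x u - x v)\<^sup>2) / 2"
proof -
  define L where "L u v = (if u = v then real d else 0) - a u v" for u v
  have entry: "grounded_laplacian n E s $$ (i, j) = L (insert_index s i) (insert_index s j)"
    if "i < n - 1" "j < n - 1" for i j
    using that E
    by (simp add: grounded_laplacian_def mat_delete_def laplacian_def degree_matrix_def
        adjacency_matrix_def L_def a_def insert_index_def regular_graphs_def)
  have deg: "(\<Sum>v<n. a u v) = real d" if "u < n" for u
    unfolding a_def using adjacency_row_sum[OF E that] .
  have drop: "(\<Sum>v\<in>{..<n} - {s}. F v) = (\<Sum>v<n. F v)" if "F s = 0" for F :: "nat \<Rightarrow> real"
    using s that by (simp add: sum.remove[of "{..<n}" s])
  have "(\<Sum>i<n - 1. \<Sum>j<n - 1. grounded_laplacian n E s $$ (i, j)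
            * (x (insert_index s i) * x (insert_index s j)))
      = (\<Sum>i<n - 1. \<Sum>j<n - 1. L (insert_index s i) (insert_index s j)
            * (x (insert_index s i) * x (insert_index s j)))"
    by (intro sum.cong refl) (simp add: entry)
  also have "\<dots> = (\<Sum>i<n - 1. \<Sum>v\<in>{..<n} - {s}. L (insert_index s i) v * (x (insert_index s i) * x v))"
    using sum_insert_index[OF s, of "\<lambda>v. L (insert_index s i) v * (x (insert_index s i) * x v)" for i]
    by simp
  also have "\<dots> = (\<Sum>u\<in>{..<n} - {s}. \<Sum>v\<in>{..<n} - {s}. L u v * (x u * x v))"
    using sum_insert_index[OF s, of "\<lambda>u. \<Sum>v\<in>{..<n} - {s}. L u v * (x u * x v)"] by simp
  also have "\<dots> = (\<Sum>u<n. \<Sum>v<n. L u v * (x u * x v))"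
    by (subst drop; simp add: x drop)
  also have "\<dots> = (\<Sum>u<n. real d * (x u)\<^sup>2) - (\<Sum>u<n. \<Sum>v<n. a u v * (x u * x v))"
    by (simp add: L_def left_diff_distrib sum_subtractf power2_eq_square if_distrib[of "\<lambda>c. c * _"]
        cong: if_cong)
  finally have lhs: "(\<Sum>i<n - 1. \<Sum>j<n - 1. grounded_laplacian n E s $$ (i, j)
            * (x (insert_index s i) * x (insert_index s j)))
      = (\<Sum>u<n. real d * (x u)\<^sup>2) - (\<Sum>u<n. \<Sum>v<n. a u v * (x u * x v))" .
  have row: "(\<Sum>u<n. \<Sum>v<n. a u v * (x u)\<^sup>2) = (\<Sum>u<n. real d * (x u)\<^sup>2)"
    by (simp add: sum_distrib_right[symmetric] deg)
  moreover have "(\<Sum>u<n. \<Sum>v<n. a u v * (x v)\<^sup>2) = (\<Sum>u<n. \<Sum>v<n. a u v * (x u)\<^sup>2)"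
    by (subst sum.swap) (simp add: a_def insert_commute)
  moreover have "(\<Sum>u<n. \<Sum>v<n. a u v * (x u - x v)\<^sup>2)
      = (\<Sum>u<n. \<Sum>v<n. a u v * (x u)\<^sup>2) + (\<Sum>u<n. \<Sum>v<n. a u v * (x v)\<^sup>2)
        - 2 * (\<Sum>u<n. \<Sum>v<n. a u v * (x u * x v))"
    by (simp add: power2_diff algebra_simps sum.distrib sum_subtractf sum_distrib_left)
  ultimately show ?thesis unfolding lhs by simp
qed

lemma grounded_laplacian_carrier: "grounded_laplacian n E s \<in> carrier_mat (n - 1) (n - 1)"
  by (simp add: grounded_laplacian_def mat_delete_def laplacian_def degree_matrix_def
      adjacency_matrix_def)

lemma grounded_laplacian_sym:
  assumes "i < n - 1" "j < n - 1"
  shows "grounded_laplacian n E s $$ (i, j) = grounded_laplacian n E s $$ (j, i)"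
  using assms
  by (simp add: grounded_laplacian_def mat_delete_def laplacian_def degree_matrix_def
      adjacency_matrix_def insert_commute)

text \<open>The test function is 1 everywhere except at \<open>s\<close>: its energy is the degree of \<open>s\<close>, and its
  squared norm is \<open>n - 1\<close>.\<close>

lemma smallest_eigenvalue_upper:
  assumes E: "E \<in> regular_graphs n d" and s: "s < n" and n: "2 \<le> n"
  shows "smallest_eigenvalue (grounded_laplacian n E s) \<le> 2 * (real d / real n)"
proof -
  let ?G = "grounded_laplacian n E s" and ?a = "\<lambda>u v. if {u, v} \<in> E then 1 else 0 :: real"
  define x where "x v = (if v = s then 0 else 1 :: real)" for v
  have one: "x (insert_index s i) = 1" for i
    by (simp add: x_def insert_index_def)
  have pick: "(\<Sum>v<n. F v * (if v = s then 1 else 0)) = F s" for F :: "nat \<Rightarrow> real"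
    using s by (simp add: if_distrib[of "\<lambda>c. _ * c"] cong: if_cong)
  have "smallest_eigenvalue ?G * real (n - 1) = smallest_eigenvalue ?G * (\<Sum>i<n - 1. (x (insert_index s i))\<^sup>2)"
    by (simp add: one)
  also have "\<dots> \<le> (\<Sum>i<n - 1. \<Sum>j<n - 1. ?G $$ (i, j) * (x (insert_index s i) * x (insert_index s j)))"
    using n by (intro smallest_eigenvalue_rayleigh(2) grounded_laplacian_carrier grounded_laplacian_sym) auto
  also have "\<dots> = (\<Sum>u<n. \<Sum>v<n. ?a u v * (x u - x v)\<^sup>2) / 2"
    by (rule grounded_laplacian_form[OF E s]) (simp add: x_def)
  also have "\<dots> \<le> (\<Sum>u<n. \<Sum>v<n. ?a u v * ((if u = s then 1 else 0) + (if v = s then 1 else 0))) / 2"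
    by (intro divide_right_mono sum_mono mult_left_mono) (auto simp: x_def)
  also have "\<dots> = ((\<Sum>u<n. (\<Sum>v<n. ?a u v) * (if u = s then 1 else 0)) + (\<Sum>u<n. ?a u s)) / 2"
    by (simp only: distrib_left sum.distrib pick sum_distrib_right)
  also have "\<dots> = real d"
    using adjacency_row_sum[OF E s] by (simp only: pick) (simp add: insert_commute)
  finally have "smallest_eigenvalue ?G \<le> real d / real (n - 1)"
    using n by (simp add: pos_le_divide_eq)
  also have "\<dots> \<le> real d / (real n / 2)"
    using n by (intro divide_left_mono) auto
  also have "\<dots> = 2 * (real d / real n)" by simp
  finally show ?thesis .
qed

lemma smallest_eigenvalue_lower:
  assumes E: "E \<in> regular_graphs n d" and ex: "expanding n E" and s: "s < n" and n: "2 \<le> n"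
    and d: "0 < d"
  shows "1 / (8 * (real d)\<^sup>2) * (real d / real n) \<le> smallest_eigenvalue (grounded_laplacian n E s)"
proof -
  let ?G = "grounded_laplacian n E s" and ?a = "\<lambda>u v. if {u, v} \<in> E then 1 else 0 :: real"
  obtain y where y: "(\<Sum>i<n - 1. (y i)\<^sup>2) = 1"
    and ev: "(\<Sum>i<n - 1. \<Sum>j<n - 1. ?G $$ (i, j) * (y i * y j)) = smallest_eigenvalue ?G"
    using smallest_eigenvalue_rayleigh(1)[OF grounded_laplacian_carrier[of n E s]]
      grounded_laplacian_sym n by fastforce
  define x where "x v = (if v = s then 0 else y (delete_index s v))" for v
  have xy: "x (insert_index s i) = y i" for i
    by (auto simp: x_def insert_index_def delete_index_def)
  have x0: "x s = 0" by (simp add: x_def)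
  have cut: "real (card S) \<le> (\<Sum>u\<in>S. \<Sum>v\<in>{..<n} - S. ?a u v)"
    if S: "S \<subseteq> {..<n}" "2 * card S \<le> n" for S
  proof -
    have fin: "finite S" using S finite_subset by blast
    have "card (links S ({..<n} - S) E) = card (Sigma S (\<lambda>u. {v \<in> {..<n} - S. {u, v} \<in> E}))"
      by (rule arg_cong[of _ _ card]) (auto simp: links_def)
    also have "\<dots> = (\<Sum>u\<in>S. card {v \<in> {..<n} - S. {u, v} \<in> E})"
      using fin by (intro card_SigmaI) auto
    finally have "real (card (links S ({..<n} - S) E)) = (\<Sum>u\<in>S. \<Sum>v\<in>{..<n} - S. ?a u v)"
      by (simp add: sum.If_cases Int_def)
    then show ?thesis using ex S by (metis expanding_def of_nat_le_iff)
  qed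
  have "(\<Sum>i<n - 1. (y i)\<^sup>2) = (\<Sum>v\<in>{..<n} - {s}. (x v)\<^sup>2)"
    using sum_insert_index[OF s, of "\<lambda>v. (x v)\<^sup>2"] by (simp add: xy)
  also have "\<dots> = (\<Sum>v<n. (x v)\<^sup>2)"
    using s x0 by (simp add: sum.remove[of "{..<n}" s])
  also have "\<dots> \<le> 4 * real n * real d * (\<Sum>u<n. \<Sum>v<n. ?a u v * (x u - x v)\<^sup>2)"
    using d s x0
    by (intro grounded_poincare[of ?a] cut adjacency_row_sum[OF E]) (auto simp: insert_commute)
  also have "(\<Sum>u<n. \<Sum>v<n. ?a u v * (x u - x v)\<^sup>2) = 2 * smallest_eigenvalue ?G"
    using grounded_laplacian_form[OF E s, of x] x0 ev by (simp add: xy)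
  finally have "1 \<le> smallest_eigenvalue ?G * (8 * real n * real d)" using y by (simp add: mult_ac)
  then have "1 / (8 * real n * real d) \<le> smallest_eigenvalue ?G"
    using n d by (simp add: pos_divide_le_eq)
  moreover have "1 / (8 * (real d)\<^sup>2) * (real d / real n) = 1 / (8 * real n * real d)"
    using d by (simp add: power2_eq_square)
  ultimately show ?thesis by simp
qed

section \<open>Random regular graphs\<close>

lemma prob_expanding:
  assumes d: "30 \<le> d" and n: "16 * d \<le> n" and ev: "even (d * n)"
  shows "1 - 1 / real n \<le> measure_pmf.prob (random_regular_graph n d)
           {E. E \<in> regular_graphs n d \<and> expanding n E}"
proof -
  let ?R = "regular_graphs n d"
  have ne: "?R \<noteq> {}" using regular_graphs_nonempty[of d n] d n ev by simp
  have fin: "finite ?R" by (rule finite_regular_graphs)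
  have pos: "0 < real (card ?R)" using ne fin by (simp add: card_gt_0_iff)
  have "card ?R = card {E \<in> ?R. expanding n E} + card {E \<in> ?R. \<not> expanding n E}"
    using fin by (subst card_Un_disjoint[symmetric]) (auto intro: arg_cong[of _ _ card])
  then have "real (card {E \<in> ?R. expanding n E}) \<ge> real (card ?R) - real (card ?R) / real n"
    using nonexpanding_count[OF d n] by linarith
  then have "(real (card ?R) - real (card ?R) / real n) / real (card ?R)
      \<le> real (card {E \<in> ?R. expanding n E}) / real (card ?R)"
    by (intro divide_right_mono) auto
  moreover have "(real (card ?R) - real (card ?R) / real n) / real (card ?R) = 1 - 1 / real n"
    using pos by (simp add: diff_divide_distrib)
  moreover have "measure_pmf.prob (random_regular_graph n d) {E. E \<in> ?R \<and> expanding n E}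
      = real (card {E \<in> ?R. expanding n E}) / real (card ?R)"
    unfolding random_regular_graph_def measure_pmf_of_set[OF ne fin] by (simp add: Int_def)
  ultimately show ?thesis by simp
qed

theorem theorem4:
  shows "\<exists>d\<^sub>0\<ge>3. \<forall>d\<ge>d\<^sub>0. \<exists>c\<^sub>1 c\<^sub>2 :: real. c\<^sub>1 > 0 \<and> c\<^sub>2 > 0 \<and>
    (\<forall>s :: nat \<Rightarrow> nat. (\<forall>n>d. s n < n) \<longrightarrow>
      ((\<lambda>n. measure_pmf.prob (random_regular_graph n d)
              {E. c\<^sub>1 * (real d / real n) \<le> smallest_eigenvalue (grounded_laplacian n E (s n)) \<and>
                  smallest_eigenvalue (grounded_laplacian n E (s n)) \<le> c\<^sub>2 * (real d / real n)})
        \<longlongrightarrow> 1) (inf sequentially (principal {n. d < n \<and> even (d * n)})))"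
proof (rule exI[of _ 30], intro conjI allI impI)
  fix d :: nat assume d: "30 \<le> d"
  let ?c = "1 / (8 * (real d)\<^sup>2)"
  show "\<exists>c\<^sub>1 c\<^sub>2 :: real. c\<^sub>1 > 0 \<and> c\<^sub>2 > 0 \<and>
    (\<forall>s :: nat \<Rightarrow> nat. (\<forall>n>d. s n < n) \<longrightarrow>
      ((\<lambda>n. measure_pmf.prob (random_regular_graph n d)
              {E. c\<^sub>1 * (real d / real n) \<le> smallest_eigenvalue (grounded_laplacian n E (s n)) \<and>
                  smallest_eigenvalue (grounded_laplacian n E (s n)) \<le> c\<^sub>2 * (real d / real n)})
        \<longlongrightarrow> 1) (inf sequentially (principal {n. d < n \<and> even (d * n)})))"
  proof (rule exI[of _ ?c], rule exI[of _ 2], intro conjI allI impI)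
    show "?c > 0" using d by simp
    fix s :: "nat \<Rightarrow> nat" assume s: "\<forall>n>d. s n < n"
    let ?F = "inf sequentially (principal {n. d < n \<and> even (d * n)})"
    let ?A = "\<lambda>n. {E. ?c * (real d / real n) \<le> smallest_eigenvalue (grounded_laplacian n E (s n)) \<and>
                  smallest_eigenvalue (grounded_laplacian n E (s n)) \<le> 2 * (real d / real n)}"
    let ?p = "\<lambda>n. measure_pmf.prob (random_regular_graph n d) (?A n)"
    have "1 - 1 / real n \<le> ?p n" if n: "16 * d \<le> n" "d < n" "even (d * n)" for n
    proof -
      have sn: "s n < n" using s n by simp
      have "{E. E \<in> regular_graphs n d \<and> expanding n E} \<subseteq> ?A n"
        using smallest_eigenvalue_lower[of _ n d "s n"] smallest_eigenvalue_upper[of _ n d "s n"] sn d n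
        by auto
      then have "measure_pmf.prob (random_regular_graph n d) {E. E \<in> regular_graphs n d \<and> expanding n E} \<le> ?p n"
        by (intro measure_pmf.finite_measure_mono) auto
      then show ?thesis using prob_expanding[OF d n(1,3)] by linarith
    qed
    then have "eventually (\<lambda>n. 1 - 1 / real n \<le> ?p n) ?F"
      unfolding eventually_inf_principal
      by (intro eventually_sequentiallyI[of "16 * d"]) auto
    moreover have "((\<lambda>n. 1 - 1 / real n) \<longlongrightarrow> 1) ?F"
    proof (rule tendsto_mono[OF inf_le1])
      show "(\<lambda>n. 1 - 1 / real n) \<longlonglongrightarrow> 1"
        using tendsto_diff[OF tendsto_const lim_1_over_n] by simp
    qed
    ultimately show "(?p \<longlongrightarrow> 1) ?F"
      by (intro tendsto_sandwich[of "\<lambda>n. 1 - 1 / real n" ?p _ "\<lambda>_. 1"]) auto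
  qed simp
qed simp

end
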